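(* Let $n$ be a positive integer and $p,q\in\mathbb{N}_0$. Then \begin{align*} \sum_{k=1}^n(-1)^k\binom{p+q+n}{q+k}H_{p+n-k}H_{q+k} &=\frac{(-1)^n}{p+q+n}\binom{p+q+n}{p}\left\{pH_{p}H_{q+n}+\frac{pH_{p}}{p+q+n}-\frac{(q+n)H_{q+n}}{p+q+n}+\frac{p-q-n}{(p+q+n)^2}\right\}\\ &\quad-\binom{p+q+n}{q}\frac{p+n}{p+q+n}\left\{H_{p+n}H_{q}+\frac{H_{p+n}}{p+q+n}-\frac{qH_{q}}{(p+n)(p+q+n)}+\frac{p-q+n}{(p+n)(p+q+n)^2}\right\}. \end{align*}
   Context: $H_0=0$ and $H_m=\sum_{j=1}^m \frac1j$ for $m\ge1$. $\binom{a}{b}$ is the usual binomial coefficient (equal to $0$ if $b>a$). *)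

theory Defs
  imports "HOL-Analysis.Harmonic_Numbers"
begin

abbreviation H :: "nat \<Rightarrow> real" where
  "H m \<equiv> harm m"

end

theory Submission
  imports Defs
begin

text \<open>
  With \<open>N = p + q + n\<close> fixed, the summand depends on \<open>k\<close> only through \<open>j = q + k\<close> (up to the
  sign \<open>(-1) ^ q\<close>), and \<open>(-1) ^ j * (N choose j) * H (N - j) * H j\<close> has a closed-form indefinite
  sum in \<open>j\<close>. The two terms on the right-hand side are its values at \<open>j = q + n\<close> and \<open>j = q\<close>.
\<close>

definition binomial_harm_antidiff :: "nat \<Rightarrow> nat \<Rightarrow> real" where
  "binomial_harm_antidiff N j = (-1) ^ j / real N * real (N choose j) *
     (real (N - j) * H (N - j) * H j + real (N - j) * H (N - j) / real N
      - real j * H j / real N + (real N - 2 * real j) / (real N)\<^sup>2)"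

text \<open>Since \<open>(N choose j) * (N - j) / N = (N - 1 choose j)\<close>, the closed form has
  leading part \<open>(-1) ^ j * (N - 1 choose j) * H (N - j) * H j\<close>, where the first two
  factors are the partial alternating sum of row \<open>N\<close> of Pascal's triangle; the other
  terms correct for the change of the harmonic factors. The check reduces both values to one
  binomial and two harmonic numbers, leaving a rational identity.\<close>

lemma binomial_harm_antidiff_Suc:
  assumes "i < N"
  shows "binomial_harm_antidiff N (Suc i) - binomial_harm_antidiff N i
    = (-1) ^ Suc i * real (N choose Suc i) * H (N - Suc i) * H (Suc i)"
proof -
  obtain m where N: "N = Suc (m + i)"
    using assms less_iff_Suc_add by (auto simp: add.commute)
  \<comment> \<open>Here \<open>M = N - i\<close> and \<open>J = i + 1\<close>; \<open>x\<close> and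
    \<open>y\<close> are the two harmonic numbers of the target summand.\<close>
  define M J B x y where "M = real m + 1" and "J = real i + 1"
    and "B = real (N choose Suc i)" and "x = H m" and "y = H (Suc i)"
  have "Suc i * (N choose Suc i) = (N - i) * (N choose i)"
    using binomial_absorb_comp[of N i] by (simp only: N Suc_times_binomial diff_Suc_1)
  then have "real (Suc i) * real (N choose Suc i) = real (N - i) * real (N choose i)"
    by (metis of_nat_mult)
  then have B: "real (N choose i) = B * J / M"
    by (simp add: N M_def J_def B_def field_simps)
  have pos: "M > 0" "J > 0" "M + J - 1 > 0"
    by (auto simp: M_def J_def)
  have eqs: "H (N - i) = x + 1 / M" "H i = y - 1 / J" "real N = M + J - 1"
    "real (N - i) = M" "real i = J - 1" "real (N - Suc i) = M - 1" "real (Suc i) = J"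
    "H (N - Suc i) = x"
    by (auto simp: N M_def J_def x_def y_def harm_Suc inverse_eq_divide)
  define S where "S = M + J - 1"
  have S: "S \<noteq> 0" "M \<noteq> 0" "J \<noteq> 0" "M = S - J + 1"
    using pos by (auto simp: S_def)
  \<comment> \<open>The signs at \<open>i\<close> and \<open>Suc i\<close> are opposite, so the
    difference turns into a sum once \<open>(-1) ^ Suc i\<close> is factored out.\<close>
  have main: "B / S * ((M - 1) * x * y + (M - 1) * x / S - J * y / S + (S - 2 * J) / S\<^sup>2)
      + (B * J / M) / S * (M * (x + 1 / M) * (y - 1 / J) + M * (x + 1 / M) / S
         - (J - 1) * (y - 1 / J) / S + (S - 2 * (J - 1)) / S\<^sup>2)
      = B * x * y"
  proof -
    have 1: "M * (x + 1 / M) = M * x + 1" "J * (y - 1 / J) = J * y - 1"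
      using S by (auto simp: field_simps)
    \<comment> \<open>The weights \<open>S\<^sup>2 * M\<close> and \<open>S\<^sup>2 * J\<close> are
      in the ratio of the two coefficients, and they clear every denominator: \<open>J\<close>
      absorbs the one in \<open>y - 1 / J\<close>, while \<open>M * (x + 1 / M)\<close> is already a
      polynomial.\<close>
    have "S\<^sup>2 * M * ((M - 1) * x * y + (M - 1) * x / S - J * y / S + (S - 2 * J) / S\<^sup>2)
      + S\<^sup>2 * J * (M * (x + 1 / M) * (y - 1 / J) + M * (x + 1 / M) / S
         - (J - 1) * (y - 1 / J) / S + (S - 2 * (J - 1)) / S\<^sup>2)
      = M * (S\<^sup>2 * (M - 1) * x * y + S * (M - 1) * x - S * J * y + (S - 2 * J))
      + (S\<^sup>2 * (M * x + 1) * (J * y - 1) + S * J * (M * x + 1)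
         - S * (J - 1) * (J * y - 1) + J * (S - 2 * (J - 1)))"
      unfolding 1(1) using S(1,3) by (simp add: field_simps power2_eq_square)
    also have "\<dots> = S ^ 3 * M * x * y"
      unfolding S(4) by algebra
    finally have "S\<^sup>2 * M * ((M - 1) * x * y + (M - 1) * x / S - J * y / S + (S - 2 * J) / S\<^sup>2)
      + S\<^sup>2 * J * (M * (x + 1 / M) * (y - 1 / J) + M * (x + 1 / M) / S
         - (J - 1) * (y - 1 / J) / S + (S - 2 * (J - 1)) / S\<^sup>2) = S ^ 3 * M * x * y" .
    \<comment> \<open>Keeping the long brackets as opaque \<open>e\<close> and \<open>e'\<close>
      prevents simplification from expanding them.\<close>
    moreover have "B / S * e + (B * J / M) / S * e' = B * x * y"
      if "S\<^sup>2 * M * e + S\<^sup>2 * J * e' = S ^ 3 * M * x * y" for e e'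
    proof -
      have "B / S * e + (B * J / M) / S * e' = B / (S ^ 3 * M) * (S\<^sup>2 * M * e + S\<^sup>2 * J * e')"
        using S(1,2) by (simp add: field_simps power2_eq_square power3_eq_cube)
      also have "\<dots> = B * x * y"
        unfolding that using S(1,2) by simp
      finally show ?thesis .
    qed
    ultimately show ?thesis
      by blast
  qed
  have combine: "(-1) ^ Suc i / S * B * e - (-1) ^ i / S * (B * J / M) * e' = (-1) ^ Suc i * B * x * y"
    if "B / S * e + (B * J / M) / S * e' = B * x * y" for e e'
  proof -
    have "(-1) ^ Suc i / S * B * e - (-1) ^ i / S * (B * J / M) * e'
        = (-1) ^ Suc i * (B / S * e + (B * J / M) / S * e')"
      by (simp add: algebra_simps)
    then show ?thesis
      unfolding that by (simp only: mult.assoc)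
  qed
  show ?thesis
    unfolding binomial_harm_antidiff_def B eqs B_def[symmetric] y_def[symmetric] S_def[symmetric]
    by (rule combine) (fact main)
qed

text \<open>Telescoping in \<open>q + k\<close>. The factor \<open>(-1) ^ q\<close> converts the
  sign \<open>(-1) ^ (q + k)\<close> of the increments into \<open>(-1) ^ k\<close>, and the bound
  on \<open>q + n\<close> keeps every increment in the range of the difference formula.\<close>

lemma sum_binomial_harm:
  assumes "q + n \<le> N"
  shows "(\<Sum>k=1..n. (-1) ^ k * real (N choose (q + k)) * H (N - (q + k)) * H (q + k))
    = (-1) ^ q * (binomial_harm_antidiff N (q + n) - binomial_harm_antidiff N q)"
  using assms
proof (induction n)
  case (Suc n)
  have "(-1) ^ Suc n * real (N choose (q + Suc n)) * H (N - (q + Suc n)) * H (q + Suc n)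
    = (-1) ^ q * (binomial_harm_antidiff N (Suc (q + n)) - binomial_harm_antidiff N (q + n))"
    using Suc.prems by (simp add: binomial_harm_antidiff_Suc power_add flip: mult.assoc power_mult_distrib)
  with Suc show ?case
    by (simp add: algebra_simps)
qed simp

theorem theorem4:
  fixes n p q :: nat
  assumes "n \<ge> 1"
  shows "(\<Sum>k=1..n. (-1) ^ k * real ((p + q + n) choose (q + k)) * H (p + n - k) * H (q + k))
    = (-1) ^ n / real (p + q + n) * real ((p + q + n) choose p) *
        (real p * H p * H (q + n)
         + real p * H p / real (p + q + n)
         - real (q + n) * H (q + n) / real (p + q + n)
         + (real p - real q - real n) / (real (p + q + n))\<^sup>2)
      - real ((p + q + n) choose q) * (real (p + n) / real (p + q + n)) *
        (H (p + n) * H q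
         + H (p + n) / real (p + q + n)
         - real q * H q / (real (p + n) * real (p + q + n))
         + (real p - real q + real n) / (real (p + n) * (real (p + q + n))\<^sup>2))"
proof -
  let ?N = "p + q + n"
  have "(\<Sum>k=1..n. (-1) ^ k * real (?N choose (q + k)) * H (p + n - k) * H (q + k))
      = (\<Sum>k=1..n. (-1) ^ k * real (?N choose (q + k)) * H (?N - (q + k)) * H (q + k))"
    by simp
  also have "\<dots> = (-1) ^ q * binomial_harm_antidiff ?N (q + n) - (-1) ^ q * binomial_harm_antidiff ?N q"
    by (subst sum_binomial_harm) (simp_all add: right_diff_distrib)
  also have "(-1) ^ q * binomial_harm_antidiff ?N (q + n) =
      (-1) ^ n / real ?N * real (?N choose p) *
        (real p * H p * H (q + n) + real p * H p / real ?N - real (q + n) * H (q + n) / real ?N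
         + (real p - real q - real n) / (real ?N)\<^sup>2)"
  proof -
    \<comment> \<open>The upper endpoint has complement \<open>p\<close>, so symmetry gives the
      binomial in the required form.\<close>
    have "?N choose (q + n) = ?N choose p"
      using binomial_symmetric[of p ?N] by simp
    moreover have "?N - (q + n) = p" "real ?N - 2 * real (q + n) = real p - real q - real n"
      by auto
    moreover have "(-1) ^ q * ((-1) ^ (q + n) :: real) = (-1) ^ n"
      by (simp add: power_add flip: mult.assoc)
    ultimately show ?thesis
      unfolding binomial_harm_antidiff_def by (simp only: times_divide_eq_right flip: mult.assoc)
  qed
  also have "(-1) ^ q * binomial_harm_antidiff ?N q =
      real (?N choose q) * (real (p + n) / real ?N) *
        (H (p + n) * H q + H (p + n) / real ?N - real q * H q / (real (p + n) * real ?N)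
         + (real p - real q + real n) / (real (p + n) * (real ?N)\<^sup>2))"
  proof -
    have *: "?N - q = p + n" "real ?N - 2 * real q = real p - real q + real n"
      by auto
    have "(-1) ^ q * ((-1) ^ q :: real) = 1"
      by (simp flip: power_mult_distrib)
    then have "(-1) ^ q * binomial_harm_antidiff ?N q = real (?N choose q) / real ?N *
        (real (p + n) * H (p + n) * H q + real (p + n) * H (p + n) / real ?N
         - real q * H q / real ?N + (real p - real q + real n) / (real ?N)\<^sup>2)"
      unfolding binomial_harm_antidiff_def *
      by (simp only: times_divide_eq_right times_divide_eq_left mult_1_left flip: mult.assoc)
    also have "real (p + n) * H (p + n) * H q + real (p + n) * H (p + n) / real ?N
         - real q * H q / real ?N + (real p - real q + real n) / (real ?N)\<^sup>2
       = real (p + n) * (H (p + n) * H q + H (p + n) / real ?N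
         - real q * H q / (real (p + n) * real ?N)
         + (real p - real q + real n) / (real (p + n) * (real ?N)\<^sup>2))"
    proof -
      \<comment> \<open>Used with \<open>c = p + n\<close>, which is nonzero because
        \<open>n \<ge> 1\<close>; extracting it puts \<open>p + n\<close> into the last two
        denominators.\<close>
      have "c * u * v + c * u / s - w / s + z / t = c * (u * v + u / s - w / (c * s) + z / (c * t))"
        if "c \<noteq> 0" for c u v w z s t :: real
        using that by (simp add: distrib_left right_diff_distrib)
      then show ?thesis
        using assms by simp
    qed
    finally show ?thesis
      by (simp only: mult.assoc times_divide_eq_left times_divide_eq_right)
  qed
  finally show ?thesis .
qed

end
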